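(* Let $m\le n$, let $A\in\mathbb{R}^{n\times n}$ be symmetric positive definite and let $B,C\in\mathbb{R}^{m\times n}$ satisfy $\operatorname{rank}(B)=\operatorname{rank}(C)=m$. For $x\in\mathbb{C}^n$ put $a(x)=x^*Ax$, $s(x)=\Re(x^*B^TCx)$ and $t(x)=\Im(x^*B^TCx)$. Let $\alpha>0$ be arbitrary and suppose that every $x\in\mathcal{S}_\alpha$ satisfies $$s(x)>0\quad\text{and}\quad |t(x)|<a(x)\sqrt{s(x)}.$$ Then $\rho(M_\alpha)<1$. Consequently, the shift-splitting (SS) iteration with parameter $\alpha$ converges, for every initial vector $\mathbf{x}^{(0)}\in\mathbb{R}^{n+m}$, to the unique solution of $\mathcal{A}\mathbf{x}=\mathbf{f}$.
   Context: $x^*$ denotes the conjugate transpose, $\rho(\cdot)$ the spectral radius, and $[x;y]=[x^T,y^T]^T$. The saddle point matrix is $$\mathcal{A}=\begin{bmatrix}A&B^T\\-C&0\end{bmatrix}\in\mathbb{R}^{(n+m)\times(n+m)},$$ and $\mathbf{f}=[b;q]\in\mathbb{R}^{n+m}$ is a given right-hand side ($b\in\mathbb{R}^n$, $q\in\mathbb{R}^m$). For $\alpha>0$ the SS iteration is $$(\alpha I+\mathcal{A})\mathbf{x}^{(k+1)}=(\alpha I-\mathcal{A})\mathbf{x}^{(k)}+2\mathbf{f},\quad k=0,1,2,\ldots,$$ and its iteration matrix is $$M_\alpha=(\alpha I+\mathcal{A})^{-1}(\alpha I-\mathcal{A})=\begin{bmatrix}\alpha I+A&B^T\\-C&\alpha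 I\end{bmatrix}^{-1}\begin{bmatrix}\alpha I-A&-B^T\\C&\alpha I\end{bmatrix}$$ (the matrix $\alpha I+\mathcal{A}$ is nonsingular under the stated assumptions). The set $\mathcal{S}_\alpha$ consists of all $x\in\mathbb{C}^n$ with $\|x\|_2=1$ for which there is $y\in\mathbb{C}^m$ such that $[x;y]$ is an eigenvector of $M_\alpha$. *)

theory Defs
  imports
    "HOL-Analysis.L2_Norm"
    "Jordan_Normal_Form.DL_Rank"
    "Jordan_Normal_Form.Spectral_Radius"
begin

definition vec_norm2 :: "'a::real_normed_vector vec \<Rightarrow> real" where
  "vec_norm2 v = L2_set (\<lambda>i. norm (v $ i)) {..<dim_vec v}"

abbreviation complex_mat :: "real mat \<Rightarrow> complex mat" where
  "complex_mat M \<equiv> map_mat complex_of_real M"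

definition sym_pos_def :: "real mat \<Rightarrow> bool" where
  "sym_pos_def A \<longleftrightarrow> square_mat A \<and> transpose_mat A = A \<and>
     (\<forall>v \<in> carrier_vec (dim_row A). v \<noteq> 0\<^sub>v (dim_row A) \<longrightarrow> v \<bullet> (A *\<^sub>v v) > 0)"

text \<open>The form \<open>x\<^sup>* M x\<close> of a real matrix at a complex vector.\<close>

definition sesq_form :: "real mat \<Rightarrow> complex vec \<Rightarrow> complex" where
  "sesq_form M x = conjugate x \<bullet> (complex_mat M *\<^sub>v x)"

text \<open>For symmetric \<open>A\<close> the value \<open>x\<^sup>* A x\<close> is real; \<open>Re\<close> only adjusts the type.\<close>

definition a_form :: "real mat \<Rightarrow> complex vec \<Rightarrow> real" where
  "a_form A x = Re (sesq_form A x)"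

definition s_form :: "real mat \<Rightarrow> real mat \<Rightarrow> complex vec \<Rightarrow> real" where
  "s_form B C x = Re (sesq_form (transpose_mat B * C) x)"

definition t_form :: "real mat \<Rightarrow> real mat \<Rightarrow> complex vec \<Rightarrow> real" where
  "t_form B C x = Im (sesq_form (transpose_mat B * C) x)"

definition saddle_mat :: "real mat \<Rightarrow> real mat \<Rightarrow> real mat \<Rightarrow> real mat" where
  "saddle_mat A B C =
     four_block_mat A (transpose_mat B) (- C) (0\<^sub>m (dim_row C) (dim_row B))"

definition shift_plus :: "real \<Rightarrow> real mat \<Rightarrow> real mat" where
  "shift_plus \<alpha> K = \<alpha> \<cdot>\<^sub>m 1\<^sub>m (dim_row K) + K"

definition shift_minus :: "real \<Rightarrow> real mat \<Rightarrow> real mat" where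
  "shift_minus \<alpha> K = \<alpha> \<cdot>\<^sub>m 1\<^sub>m (dim_row K) - K"

text \<open>The inverse as a total function: singular matrices are sent to the zero matrix.\<close>

definition inv_mat :: "'a::field mat \<Rightarrow> 'a mat" where
  "inv_mat M = (case mat_inverse M of Some N \<Rightarrow> N | None \<Rightarrow> 0\<^sub>m (dim_col M) (dim_row M))"

definition ss_mat :: "real \<Rightarrow> real mat \<Rightarrow> real mat" where
  "ss_mat \<alpha> K = inv_mat (shift_plus \<alpha> K) * shift_minus \<alpha> K"

definition S_set :: "real \<Rightarrow> real mat \<Rightarrow> real mat \<Rightarrow> real mat \<Rightarrow> complex vec set" where
  "S_set \<alpha> A B C = {x \<in> carrier_vec (dim_row A). vec_norm2 x = 1 \<and>
     (\<exists>y \<in> carrier_vec (dim_row B). \<exists>\<mu>.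
        eigenvector (complex_mat (ss_mat \<alpha> (saddle_mat A B C))) (x @\<^sub>v y) \<mu>)}"

definition ss_iteration ::
    "real \<Rightarrow> real mat \<Rightarrow> real vec \<Rightarrow> real vec \<Rightarrow> (nat \<Rightarrow> real vec) \<Rightarrow> bool" where
  "ss_iteration \<alpha> K f x0 X \<longleftrightarrow> X 0 = x0 \<and>
     (\<forall>k. X k \<in> carrier_vec (dim_row K) \<and>
        shift_plus \<alpha> K *\<^sub>v X (Suc k) = shift_minus \<alpha> K *\<^sub>v X k + 2 \<cdot>\<^sub>v f)"

end

theory Submission
  imports Defs
begin

text \<open>An eigenvector \<open>[x; y]\<close> of \<open>M\<^sub>\<alpha>\<close> for \<open>\<mu>\<close> is one of the saddle point matrix for
  \<open>\<theta> = \<alpha> (1 - \<mu>) / (1 + \<mu>)\<close>, and \<open>|\<mu>| < 1\<close> iff \<open>Re \<theta> > 0\<close>. Full rank of \<open>B\<close> forces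
  \<open>x \<noteq> 0\<close>, and eliminating \<open>y\<close> gives \<open>\<theta>\<^sup>2 - a(x) \<theta> + s(x) + i t(x) = 0\<close> for \<open>x\<close> of norm one.
  Both roots of this quadratic lie in the right half plane when \<open>s > 0\<close> and \<open>|t| < a \<surd>s\<close>.
  The error of the iteration is multiplied by \<open>M\<^sub>\<alpha>\<close> in each step, so it tends to \<open>0\<close>.\<close>

section \<open>Location of the roots of the quadratic\<close>

text \<open>Suppose \<open>Re z \<le> 0\<close>. The imaginary part of the equation gives
  \<open>\<bar>t\<bar> = \<bar>Im z\<bar> * (a - 2 * Re z)\<close>, and the bound on
  \<open>t\<close> then forces \<open>(Im z)\<^sup>2 < s\<close>. Hence the real part
  \<open>(Re z)\<^sup>2 - a * Re z + (s - (Im z)\<^sup>2)\<close> is strictly positive and cannot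
  vanish.\<close>

lemma quadratic_root_Re_pos:
  fixes z :: complex and a s t :: real
  assumes z: "z\<^sup>2 - of_real a * z + Complex s t = 0"
    and s: "s > 0" and t: "\<bar>t\<bar> < a * sqrt s"
  shows "Re z > 0"
proof (rule ccontr)
  assume "\<not> Re z > 0"
  then have u: "Re z \<le> 0" by simp
  have re: "(Re z)\<^sup>2 - (Im z)\<^sup>2 - a * Re z + s = 0"
    using arg_cong[OF z, of Re] by (simp add: power2_eq_square)
  have im: "t = Im z * (a - 2 * Re z)"
    using arg_cong[OF z, of Im] by (simp add: power2_eq_square algebra_simps)
  have a: "a > 0" using s t
    by (metis abs_ge_zero le_less_trans real_sqrt_gt_zero zero_less_mult_pos2)
  have "\<bar>Im z\<bar> * (a - 2 * Re z) = \<bar>t\<bar>" using im u a by (simp add: abs_mult)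
  also have "\<dots> < a * sqrt s" by (rule t)
  also have "\<dots> \<le> sqrt s * (a - 2 * Re z)"
    using u s mult_nonpos_nonneg[of "Re z" "sqrt s"] by (simp add: algebra_simps)
  finally have "\<bar>Im z\<bar> < sqrt s" using u a by (simp add: mult_less_cancel_right)
  then have "(Im z)\<^sup>2 < s" by (metis abs_ge_zero power2_abs real_sqrt_abs real_sqrt_less_iff)
  moreover have "a * Re z \<le> 0" using a u by (simp add: mult_nonneg_nonpos)
  ultimately show False using re zero_le_power2[of "Re z"] by linarith
qed

section \<open>Hermitian forms and the Euclidean norm\<close>

text \<open>Conjugating the double sum exchanges the roles of \<open>i\<close> and \<open>j\<close>,
  and the symmetry of \<open>A\<close> undoes this, so the value is its own conjugate.\<close>

lemma sesq_form_symmetric: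
  assumes A: "A \<in> carrier_mat n n" and sym: "transpose_mat A = A" and x: "x \<in> carrier_vec n"
  shows "sesq_form A x = complex_of_real (a_form A x)"
proof -
  have form: "sesq_form A x = (\<Sum>i<n. \<Sum>j<n. cnj (x $ i) * (of_real (A $$ (i, j)) * x $ j))"
    using A x
    by (auto simp: sesq_form_def scalar_prod_def lessThan_atLeast0 sum_distrib_left
        intro!: sum.cong)
  have sym': "A $$ (i, j) = A $$ (j, i)" if "i < n" "j < n" for i j
    using A sym that by (metis carrier_matD index_transpose_mat(1))
  have "cnj (sesq_form A x) = (\<Sum>i<n. \<Sum>j<n. x $ i * (of_real (A $$ (i, j)) * cnj (x $ j)))"
    by (simp add: form)
  also have "\<dots> = (\<Sum>j<n. \<Sum>i<n. x $ i * (of_real (A $$ (i, j)) * cnj (x $ j)))"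
    by (rule sum.swap)
  also have "\<dots> = sesq_form A x"
    unfolding form by (intro sum.cong refl) (simp add: sym' ac_simps)
  finally show ?thesis
    by (metis Reals_cnj_iff a_form_def complex_is_Real_iff of_real_Re)
qed

lemma conjugate_scalar_prod_self:
  "conjugate x \<bullet> (x :: complex vec) = complex_of_real ((vec_norm2 x)\<^sup>2)"
proof -
  have "conjugate x \<bullet> x = (\<Sum>i<dim_vec x. complex_of_real ((norm (x $ i))\<^sup>2))"
    by (auto simp: scalar_prod_def lessThan_atLeast0 complex_norm_square mult.commute simp del: of_real_power
        intro!: sum.cong)
  then show ?thesis
    by (simp add: vec_norm2_def L2_set_def sum_nonneg)
qed

lemma vec_norm2_nonneg: "vec_norm2 v \<ge> 0"
  by (simp add: vec_norm2_def L2_set_nonneg)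

lemma vec_norm2_smult:
  "vec_norm2 (c \<cdot>\<^sub>v x) = norm c * vec_norm2 (x :: 'a::real_normed_field vec)"
  by (auto simp: vec_norm2_def L2_set_right_distrib norm_mult intro!: L2_set_cong)

lemma vec_norm2_eq_0_iff: "x \<in> carrier_vec n \<Longrightarrow> vec_norm2 x = 0 \<longleftrightarrow> x = 0\<^sub>v n"
  by (auto simp: vec_norm2_def L2_set_eq_0_iff)

section \<open>Full row rank and the kernel of the transpose\<close>

text \<open>A maximal independent set of columns of \<open>B\<close> has \<open>m\<close> elements
  and so forms a nonsingular square matrix \<open>D\<close>. The entries of
  \<open>D\<^sup>T y\<close> occur among those of \<open>B\<^sup>T y\<close>, hence vanish.\<close>

lemma transpose_mult_vec_eq_0_of_full_rank:
  fixes B :: "real mat"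
  assumes B: "B \<in> carrier_mat m n" and rank: "vec_space.rank m B = m"
    and y: "y \<in> carrier_vec m" and By: "transpose_mat (complex_mat B) *\<^sub>v y = 0\<^sub>v n"
  shows "y = 0\<^sub>v m"
proof -
  interpret vec_space "TYPE(real)" m .
  obtain S where S: "finite S" "maximal S (\<lambda>T. T \<subseteq> set (cols B) \<and> lin_indpt T)"
    using maximal_exists_superset[of "set (cols B)" "\<lambda>T. T \<subseteq> set (cols B) \<and> lin_indpt T" "{}"]
    by (auto simp: lin_dep_def)
  then have sub: "S \<subseteq> set (cols B)" and li: "lin_indpt S" by (auto simp: maximal_def)
  have card: "card S = m" using rank_card_indpt[OF B S(2)] rank by simp
  obtain xs where xs: "set xs = S" "distinct xs" using finite_distinct_list[OF S(1)] by blast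
  have len: "length xs = m" using xs card distinct_card by metis
  have xs_carrier: "set xs \<subseteq> carrier_vec m" using xs sub B cols_dim by blast
  define D where "D = mat_of_cols m xs"
  have D: "D \<in> carrier_mat m m" and cols_D: "cols D = xs"
    using len xs_carrier by (auto simp: D_def)
  have "rank D = m" using lin_indpt_full_rank[OF D] cols_D xs li by simp
  then have "det (transpose_mat D) \<noteq> 0" using det_rank_iff[OF D] det_transpose[OF D] by simp
  \<comment> \<open>The rank is taken over the reals but \<open>y\<close> is complex; the
    determinant carries nonsingularity across the embedding.\<close>
  then have det: "det (complex_mat (transpose_mat D)) \<noteq> 0" by (simp add: of_real_hom.hom_det)
  have "complex_mat (transpose_mat D) *\<^sub>v y = 0\<^sub>v m"
  proof (rule eq_vecI)
    fix i assume "i < dim_vec (0\<^sub>v m)"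
    then have i: "i < m" by simp
    have "col D i \<in> set (cols B)"
      using i cols_D D xs(1) sub len by (metis carrier_matD(2) cols_nth nth_mem subsetD)
    then obtain j where j: "j < n" "col D i = col B j"
      using B by (auto simp: in_set_conv_nth)
    have "(complex_mat (transpose_mat D) *\<^sub>v y) $ i = map_vec of_real (col D i) \<bullet> y"
      using D i y by (auto simp: scalar_prod_def)
    also have "\<dots> = (transpose_mat (complex_mat B) *\<^sub>v y) $ j"
      using B y j by (auto simp: scalar_prod_def)
    finally show "(complex_mat (transpose_mat D) *\<^sub>v y) $ i = 0\<^sub>v m $ i" using By i j by simp
  qed (use D in auto)
  then show ?thesis
    using det det_0_iff_vec_prod_zero_field[of "complex_mat (transpose_mat D)" m] D y by auto
qed

section \<open>Eigenvectors of the saddle point matrix\<close>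

lemma complex_saddle_mat_mult_vec:
  assumes A: "A \<in> carrier_mat n n" and B: "B \<in> carrier_mat m n" and C: "C \<in> carrier_mat m n"
    and x: "x \<in> carrier_vec n" and y: "y \<in> carrier_vec m"
  shows "complex_mat (saddle_mat A B C) *\<^sub>v (x @\<^sub>v y) =
    (complex_mat A *\<^sub>v x + transpose_mat (complex_mat B) *\<^sub>v y) @\<^sub>v - (complex_mat C *\<^sub>v x)"
proof -
  have "complex_mat (saddle_mat A B C) =
      four_block_mat (complex_mat A) (transpose_mat (complex_mat B)) (- complex_mat C) (0\<^sub>m m m)"
    using A B C by (intro eq_matI) (auto simp: saddle_mat_def)
  also have "\<dots> *\<^sub>v (x @\<^sub>v y) = (complex_mat A *\<^sub>v x + transpose_mat (complex_mat B) *\<^sub>v y) @\<^sub>v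
      (- complex_mat C *\<^sub>v x + 0\<^sub>m m m *\<^sub>v y)"
    using A B C x y by (intro four_block_mat_mult_vec) auto
  also have "- complex_mat C *\<^sub>v x + 0\<^sub>m m m *\<^sub>v y = - (complex_mat C *\<^sub>v x)"
    using C x y by (intro eq_vecI) auto
  finally show ?thesis .
qed

lemma eigenvector_smult:
  fixes M :: "'a::field mat"
  assumes M: "M \<in> carrier_mat n n" and v: "eigenvector M v k" and c: "c \<noteq> 0"
  shows "eigenvector M (c \<cdot>\<^sub>v v) k"
proof -
  have v': "v \<in> carrier_vec n" "v \<noteq> 0\<^sub>v n" "M *\<^sub>v v = k \<cdot>\<^sub>v v"
    using v M by (auto simp: eigenvector_def)
  have "c \<cdot>\<^sub>v v \<noteq> 0\<^sub>v n" using v'(1,2) c by (auto simp: vec_eq_iff)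
  moreover have "M *\<^sub>v (c \<cdot>\<^sub>v v) = k \<cdot>\<^sub>v (c \<cdot>\<^sub>v v)"
    using mult_mat_vec[OF M v'(1), of c] by (simp add: v'(3) smult_smult_assoc mult.commute)
  ultimately show ?thesis using M v'(1) by (simp add: eigenvector_def)
qed

text \<open>The quadratic equation for \<open>\<theta>\<close> arises by multiplying the first block row by \<open>\<theta> x\<^sup>*\<close> and
  replacing \<open>\<theta> y\<close> by \<open>- C x\<close>.\<close>

lemma saddle_eigenvalue_Re_pos:
  assumes A: "A \<in> carrier_mat n n" "transpose_mat A = A"
    and B: "B \<in> carrier_mat m n" "vec_space.rank m B = m"
    and C: "C \<in> carrier_mat m n"
    and v: "eigenvector (complex_mat (saddle_mat A B C)) v \<theta>"
    and S: "\<And>x y. x \<in> carrier_vec n \<Longrightarrow> y \<in> carrier_vec m \<Longrightarrow> vec_norm2 x = 1 \<Longrightarrow>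
      eigenvector (complex_mat (saddle_mat A B C)) (x @\<^sub>v y) \<theta> \<Longrightarrow>
      s_form B C x > 0 \<and> \<bar>t_form B C x\<bar> < a_form A x * sqrt (s_form B C x)"
  shows "Re \<theta> > 0"
proof -
  let ?K = "complex_mat (saddle_mat A B C)"
  let ?A = "complex_mat A" and ?C = "complex_mat C" and ?B = "complex_mat B"
  have K: "?K \<in> carrier_mat (n + m) (n + m)" using A B C by (simp add: saddle_mat_def)
  have blocks: "?A *\<^sub>v x + transpose_mat ?B *\<^sub>v y = \<theta> \<cdot>\<^sub>v x \<and> - (?C *\<^sub>v x) = \<theta> \<cdot>\<^sub>v y"
    if x: "x \<in> carrier_vec n" and y: "y \<in> carrier_vec m" and e: "eigenvector ?K (x @\<^sub>v y) \<theta>"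
    for x y
  proof -
    have "(?A *\<^sub>v x + transpose_mat ?B *\<^sub>v y) @\<^sub>v - (?C *\<^sub>v x) = \<theta> \<cdot>\<^sub>v (x @\<^sub>v y)"
      using e complex_saddle_mat_mult_vec[OF A(1) B(1) C x y] by (simp add: eigenvector_def)
    also have "\<dots> = (\<theta> \<cdot>\<^sub>v x) @\<^sub>v (\<theta> \<cdot>\<^sub>v y)" by (intro eq_vecI) auto
    finally show ?thesis
      by (subst (asm) append_vec_eq[of _ n]) (use A B x y in auto)
  qed
  define x0 y0 where "x0 = vec_first v n" and "y0 = vec_last v m"
  have v_carrier: "v \<in> carrier_vec (n + m)" and v0: "v \<noteq> 0\<^sub>v (n + m)"
    using v K by (auto simp: eigenvector_def)
  have v_split: "v = x0 @\<^sub>v y0" and x0: "x0 \<in> carrier_vec n" and y0: "y0 \<in> carrier_vec m"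
    using v_carrier by (auto simp: x0_def y0_def)
  \<comment> \<open>With \<open>x0 = 0\<close> the first block row reduces to
    \<open>B\<^sup>T y0 = 0\<close>, so full rank would make all of \<open>v\<close> zero.\<close>
  have "x0 \<noteq> 0\<^sub>v n"
  proof
    assume z: "x0 = 0\<^sub>v n"
    have "transpose_mat ?B *\<^sub>v y0 = 0\<^sub>v n"
    proof -
      have "complex_mat A *\<^sub>v 0\<^sub>v n = 0\<^sub>v n" using A(1) by (intro eq_vecI) auto
      moreover have "\<theta> \<cdot>\<^sub>v 0\<^sub>v n = 0\<^sub>v n" by (intro eq_vecI) auto
      moreover have "transpose_mat ?B *\<^sub>v y0 \<in> carrier_vec n" using B(1) y0 by auto
      ultimately show ?thesis using blocks[OF x0 y0] v by (simp add: z v_split)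
    qed
    then have "y0 = 0\<^sub>v m" by (rule transpose_mult_vec_eq_0_of_full_rank[OF B y0])
    then have "v = 0\<^sub>v n @\<^sub>v 0\<^sub>v m" by (simp add: v_split z)
    also have "\<dots> = 0\<^sub>v (n + m)" by (intro eq_vecI) auto
    finally show False using v0 by simp
  qed
  then have nz: "vec_norm2 x0 \<noteq> 0" using vec_norm2_eq_0_iff[OF x0] by simp
  \<comment> \<open>The scaling normalises the upper block only, as the definition of
    \<open>S_set\<close> demands.\<close>
  define c where "c = complex_of_real (1 / vec_norm2 x0)"
  define x y where "x = c \<cdot>\<^sub>v x0" and "y = c \<cdot>\<^sub>v y0"
  have x: "x \<in> carrier_vec n" and y: "y \<in> carrier_vec m" using x0 y0 by (auto simp: x_def y_def)
  have norm_x: "vec_norm2 x = 1"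
    using nz vec_norm2_nonneg[of x0] by (simp add: x_def c_def vec_norm2_smult norm_divide)
  have "x @\<^sub>v y = c \<cdot>\<^sub>v v" by (intro eq_vecI) (auto simp: v_split x_def y_def)
  then have e: "eigenvector ?K (x @\<^sub>v y) \<theta>"
    using eigenvector_smult[OF K v] nz by (simp add: c_def)
  have st: "s_form B C x > 0" "\<bar>t_form B C x\<bar> < a_form A x * sqrt (s_form B C x)"
    using S[OF x y norm_x e] by auto
  have cx: "conjugate x \<in> carrier_vec n" using x by simp
  have By: "transpose_mat ?B *\<^sub>v y \<in> carrier_vec n" using B(1) y by auto
  have tr: "complex_mat (transpose_mat B) = transpose_mat ?B" by (intro eq_matI) auto
  \<comment> \<open>The second block row enters as \<open>C x = - \<theta> y\<close>. Nothing is
    divided by \<open>\<theta>\<close>, so the argument includes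
    \<open>\<theta> = 0\<close>.\<close>
  have "complex_mat (transpose_mat B * C) *\<^sub>v x = transpose_mat ?B *\<^sub>v (?C *\<^sub>v x)"
    using B(1) C x
    by (simp add: of_real_hom.mat_hom_mult[of _ n m _ n] tr
        assoc_mult_mat_vec[of _ n m _ n])
  also have "?C *\<^sub>v x = - (\<theta> \<cdot>\<^sub>v y)"
    using blocks[OF x y e] by (metis uminus_uminus_vec)
  also have "transpose_mat ?B *\<^sub>v - (\<theta> \<cdot>\<^sub>v y) = - \<theta> \<cdot>\<^sub>v (transpose_mat ?B *\<^sub>v y)"
  proof -
    have "- (\<theta> \<cdot>\<^sub>v y) = (- \<theta>) \<cdot>\<^sub>v y" by (intro eq_vecI) auto
    then show ?thesis using B(1) y mult_mat_vec[of "transpose_mat ?B" n m y "- \<theta>"] by simp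
  qed
  finally have BC: "sesq_form (transpose_mat B * C) x = - \<theta> * (conjugate x \<bullet> (transpose_mat ?B *\<^sub>v y))"
    unfolding sesq_form_def using cx By by (simp add: scalar_prod_smult_distrib)
  \<comment> \<open>This is the first block row paired with \<open>x\<close>; the right-hand side
    collapses to \<open>\<theta>\<close> because \<open>x\<close> has norm one.\<close>
  have "sesq_form A x + conjugate x \<bullet> (transpose_mat ?B *\<^sub>v y) = conjugate x \<bullet> (\<theta> \<cdot>\<^sub>v x)"
    unfolding sesq_form_def using blocks[OF x y e] scalar_prod_add_distrib[OF cx _ By] A(1) x
    by (metis map_carrier_mat mult_mat_vec_carrier)
  also have "\<dots> = \<theta>" using x cx norm_x by (simp add: conjugate_scalar_prod_self)
  finally have "conjugate x \<bullet> (transpose_mat ?B *\<^sub>v y) = \<theta> - of_real (a_form A x)"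
    using sesq_form_symmetric[OF A x] by (simp add: algebra_simps)
  then have "\<theta>\<^sup>2 - of_real (a_form A x) * \<theta> + sesq_form (transpose_mat B * C) x = 0"
    unfolding BC by (simp only:) (simp add: algebra_simps power2_eq_square)
  moreover have "sesq_form (transpose_mat B * C) x = Complex (s_form B C x) (t_form B C x)"
    by (simp add: s_form_def t_form_def complex_eq_iff)
  ultimately show ?thesis using quadratic_root_Re_pos st by metis
qed

section \<open>The total inverse and linear systems\<close>

text \<open>An inverse \<open>N\<close> returned by \<open>mat_inverse\<close> would satisfy
  \<open>det M * det N = 1\<close>, so only the default value remains. This is what rules out a
  singular shifted matrix later.\<close>

lemma inv_mat_singular:
  fixes M :: "'a::field mat"
  assumes M: "M \<in> carrier_mat n n" and det: "det M = 0"
  shows "inv_mat M = 0\<^sub>m n n"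
proof (cases "mat_inverse M")
  case None
  then show ?thesis using M by (simp add: inv_mat_def)
next
  case (Some N)
  then have "M * N = 1\<^sub>m n" "N \<in> carrier_mat n n" using mat_inverse(2)[OF M] by auto
  then have "det M * det N = 1" using det_mult[OF M] by (metis det_one)
  then show ?thesis using det by simp
qed

lemma inv_mat_nonsingular:
  fixes M :: "'a::field mat"
  assumes M: "M \<in> carrier_mat n n" and det: "det M \<noteq> 0"
  shows "inv_mat M \<in> carrier_mat n n" "M * inv_mat M = 1\<^sub>m n" "inv_mat M * M = 1\<^sub>m n"
proof -
  \<comment> \<open>\<open>undefined\<close> fills the free record-extension argument of
    \<open>ring_mat\<close>; using the same value twice makes the two facts about units contradict
    each other in the case \<open>None\<close>.\<close>
  obtain N where N: "mat_inverse M = Some N"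
    using mat_inverse(1)[OF M, of undefined] det_non_zero_imp_unit[OF M det, of undefined]
    by (cases "mat_inverse M") auto
  show "inv_mat M \<in> carrier_mat n n" "M * inv_mat M = 1\<^sub>m n" "inv_mat M * M = 1\<^sub>m n"
    using mat_inverse(2)[OF M N] by (auto simp: inv_mat_def N)
qed

lemma nonsingular_mult_vec_eq_iff:
  fixes M :: "'a::field mat"
  assumes M: "M \<in> carrier_mat n n" and det: "det M \<noteq> 0"
    and v: "v \<in> carrier_vec n" and w: "w \<in> carrier_vec n"
  shows "M *\<^sub>v v = w \<longleftrightarrow> v = inv_mat M *\<^sub>v w"
proof
  note inv = inv_mat_nonsingular[OF M det]
  show "v = inv_mat M *\<^sub>v w" if "M *\<^sub>v v = w"
    using assoc_mult_mat_vec[OF inv(1) M v] inv(3) that v by simp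
  show "M *\<^sub>v v = w" if "v = inv_mat M *\<^sub>v w"
    using assoc_mult_mat_vec[OF M inv(1) w] inv(2) that w by simp
qed

lemma nonsingular_mult_vec_cancel:
  fixes M :: "'a::field mat"
  assumes M: "M \<in> carrier_mat n n" and det: "det M \<noteq> 0"
    and v: "v \<in> carrier_vec n" and w: "w \<in> carrier_vec n"
  shows "M *\<^sub>v v = M *\<^sub>v w \<longleftrightarrow> v = w"
  using nonsingular_mult_vec_eq_iff[OF M det v mult_mat_vec_carrier[OF M w]]
    nonsingular_mult_vec_eq_iff[OF M det w mult_mat_vec_carrier[OF M w]]
  by metis

lemma vec_diff_eq_iff:
  fixes u v w :: "'a::ab_group_add vec"
  assumes "u \<in> carrier_vec n" "v \<in> carrier_vec n" "w \<in> carrier_vec n"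
  shows "u - v = w \<longleftrightarrow> u = v + w"
proof
  show "u = v + w" if "u - v = w" using that assms by (auto intro!: eq_vecI)
  show "u - v = w" if "u = v + w" using that assms by (auto intro!: eq_vecI)
qed

section \<open>Powers of matrices and the spectral radius\<close>

text \<open>The recursion of \<open>^\<^sub>m\<close> appends the new factor on the right, whereas a
  step of the iteration applies the matrix on the left.\<close>

lemma pow_mat_Suc_left:
  fixes M :: "'a::semiring_1 mat"
  assumes M: "M \<in> carrier_mat n n"
  shows "M ^\<^sub>m Suc k = M * M ^\<^sub>m k"
proof (induction k)
  case 0
  then show ?case using M by simp
next
  case (Suc k)
  then show ?case using assoc_mult_mat[OF M pow_carrier_mat[OF M] M] by simp
qed

lemma pow_smult_mat:
  fixes M :: "'a::comm_semiring_1 mat"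
  assumes M: "M \<in> carrier_mat n n"
  shows "(c \<cdot>\<^sub>m M) ^\<^sub>m k = c ^ k \<cdot>\<^sub>m M ^\<^sub>m k"
proof (induction k)
  case 0
  then show ?case using M by (intro eq_matI) auto
next
  case (Suc k)
  have Mk: "M ^\<^sub>m k \<in> carrier_mat n n" using M by simp
  have "(c \<cdot>\<^sub>m M) ^\<^sub>m Suc k = (c ^ k \<cdot>\<^sub>m M ^\<^sub>m k) * (c \<cdot>\<^sub>m M)" using Suc by simp
  also have "\<dots> = c \<cdot>\<^sub>m ((c ^ k \<cdot>\<^sub>m M ^\<^sub>m k) * M)"
    using Mk M by (intro mult_smult_distrib) auto
  also have "(c ^ k \<cdot>\<^sub>m M ^\<^sub>m k) * M = c ^ k \<cdot>\<^sub>m (M ^\<^sub>m k * M)"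
    using Mk M by (intro mult_smult_assoc_mat) auto
  finally show ?case using Mk M by (intro eq_matI) (auto simp: ac_simps)
qed

text \<open>Powers of \<open>M / r\<close> with \<open>\<rho>(M) < r < 1\<close> are bounded, so the entries of \<open>M\<^sup>k\<close> are
  \<open>O(r\<^sup>k)\<close>.\<close>

lemma pow_mat_tendsto_0:
  fixes M :: "complex mat"
  assumes M: "M \<in> carrier_mat n n" and n: "n > 0" and \<rho>: "spectral_radius M < 1"
    and ij: "i < n" "j < n"
  shows "(\<lambda>k. (M ^\<^sub>m k) $$ (i, j)) \<longlonglongrightarrow> 0"
proof -
  \<comment> \<open>For positive dimension the spectral radius is the modulus of an eigenvalue. Its
    nonnegativity makes \<open>r\<close> positive, so that \<open>M\<close> can be divided by
    \<open>r\<close>.\<close>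
  have "spectral_radius M \<ge> 0" using spectral_radius_mem_max(1)[OF M n] by auto
  moreover obtain r where "spectral_radius M < r" "r < 1" using dense[OF \<rho>] by blast
  ultimately have r: "spectral_radius M < r" "r < 1" "r > 0" by auto
  define N where "N = complex_of_real (1 / r) \<cdot>\<^sub>m M"
  have N: "N \<in> carrier_mat n n" using M by (simp add: N_def)
  have M_N: "M = complex_of_real r \<cdot>\<^sub>m N" using r by (intro eq_matI) (auto simp: N_def)
  \<comment> \<open>An eigenvalue \<open>\<mu>\<close> of \<open>N\<close> of maximal modulus,
    multiplied by \<open>r\<close>, is an eigenvalue of \<open>M\<close>. Hence
    \<open>r * norm \<mu> \<le> spectral_radius M < r\<close>, and \<open>N\<close> has spectral
    radius below one.\<close>
  obtain \<mu> where \<mu>: "eigenvalue N \<mu>" "spectral_radius N = norm \<mu>"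
    using spectral_radius_mem_max(1)[OF N n] by (auto simp: spectrum_def)
  obtain v where v: "v \<in> carrier_vec n" "v \<noteq> 0\<^sub>v n" "N *\<^sub>v v = \<mu> \<cdot>\<^sub>v v"
    using \<mu>(1) N by (auto simp: eigenvalue_def eigenvector_def)
  have "M *\<^sub>v v = (of_real r * \<mu>) \<cdot>\<^sub>v v"
  proof -
    have "M *\<^sub>v v = of_real r \<cdot>\<^sub>v (N *\<^sub>v v)"
      using v(1) N by (intro eq_vecI) (auto simp: M_N)
    then show ?thesis by (simp add: v(3) smult_smult_assoc)
  qed
  then have "of_real r * \<mu> \<in> spectrum M"
    using v M by (auto simp: spectrum_def eigenvalue_def eigenvector_def)
  then have "norm (of_real r * \<mu>) \<le> spectral_radius M"
    using spectral_radius_mem_max(2)[OF M n] by blast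
  then have "r * norm \<mu> \<le> spectral_radius M" using r by (simp add: norm_mult)
  then have "r * norm \<mu> < r * 1" using r(1) by linarith
  then have "spectral_radius N < 1" using mult_less_cancel_left_pos[OF r(3)] \<mu>(2) by metis
  then obtain b where b: "\<And>k. norm_bound (N ^\<^sub>m k) b"
    using spectral_radius_jnf_norm_bound_less_1_upper_triangular[OF N] by blast
  have bound: "norm ((M ^\<^sub>m k) $$ (i, j)) \<le> r ^ k * b" for k
  proof -
    have "norm ((N ^\<^sub>m k) $$ (i, j)) \<le> b" using b[of k] N ij by (auto simp: norm_bound_def)
    moreover have "(M ^\<^sub>m k) $$ (i, j) = of_real r ^ k * (N ^\<^sub>m k) $$ (i, j)"
      using N ij by (simp add: M_N pow_smult_mat)
    ultimately show ?thesis using r by (simp add: norm_mult norm_power mult_left_mono)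
  qed
  have "(\<lambda>k. r ^ k) \<longlonglongrightarrow> 0" using r by (intro LIMSEQ_realpow_zero) auto
  then show ?thesis by (rule tendsto_0_le[where K = b]) (use r bound in auto)
qed

text \<open>Entrywise convergence of the complex powers descends to the real ones, and the norm is a
  continuous function of finitely many entries.\<close>

lemma vec_norm2_pow_mat_mult_vec_tendsto_0:
  fixes M :: "real mat"
  assumes M: "M \<in> carrier_mat n n" and n: "n > 0" and \<rho>: "spectral_radius (complex_mat M) < 1"
    and v: "v \<in> carrier_vec n"
  shows "(\<lambda>k. vec_norm2 (M ^\<^sub>m k *\<^sub>v v)) \<longlonglongrightarrow> 0"
proof -
  have entry: "(\<lambda>k. (M ^\<^sub>m k) $$ (i, j)) \<longlonglongrightarrow> 0" if "i < n" "j < n" for i j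
  proof -
    have "(\<lambda>k. (complex_mat M ^\<^sub>m k) $$ (i, j)) \<longlonglongrightarrow> 0"
      using M by (intro pow_mat_tendsto_0[OF _ n \<rho> that]) simp
    moreover have "(complex_mat M ^\<^sub>m k) $$ (i, j) = of_real ((M ^\<^sub>m k) $$ (i, j))" for k
      using M that by (simp add: of_real_hom.mat_hom_pow[OF M, symmetric])
    ultimately have "(\<lambda>k. complex_of_real ((M ^\<^sub>m k) $$ (i, j))) \<longlonglongrightarrow> complex_of_real 0" by simp
    then show ?thesis by (simp only: tendsto_of_real_iff)
  qed
  have norm: "vec_norm2 (M ^\<^sub>m k *\<^sub>v v) = sqrt (\<Sum>i<n. (\<Sum>j<n. (M ^\<^sub>m k) $$ (i, j) * v $ j)\<^sup>2)" for k
    using M v by (simp add: vec_norm2_def L2_set_def scalar_prod_def lessThan_atLeast0)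
  have "(\<lambda>k. sqrt (\<Sum>i<n. (\<Sum>j<n. (M ^\<^sub>m k) $$ (i, j) * v $ j)\<^sup>2)) \<longlonglongrightarrow> sqrt (\<Sum>i<n. (\<Sum>j<n. 0 * v $ j)\<^sup>2)"
    using entry by (intro tendsto_intros) auto
  then show ?thesis by (simp add: norm)
qed

section \<open>Shifted matrices and the Cayley transform\<close>

lemma shift_mult_vec:
  assumes K: "K \<in> carrier_mat N N" and v: "v \<in> carrier_vec N"
  shows "shift_plus \<alpha> K *\<^sub>v v = \<alpha> \<cdot>\<^sub>v v + K *\<^sub>v v" "shift_minus \<alpha> K *\<^sub>v v = \<alpha> \<cdot>\<^sub>v v - K *\<^sub>v v"
  using K v
  by (auto simp: shift_plus_def shift_minus_def add_mult_distrib_mat_vec[of _ N N]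
      minus_mult_distrib_mat_vec[of _ N N] intro!: eq_vecI)

lemma complex_shift_mult_vec:
  assumes K: "K \<in> carrier_mat N N" and v: "v \<in> carrier_vec N"
  shows "complex_mat (shift_plus \<alpha> K) *\<^sub>v v = of_real \<alpha> \<cdot>\<^sub>v v + complex_mat K *\<^sub>v v"
    "complex_mat (shift_minus \<alpha> K) *\<^sub>v v = of_real \<alpha> \<cdot>\<^sub>v v - complex_mat K *\<^sub>v v"
proof -
  have "complex_mat (shift_plus \<alpha> K) = of_real \<alpha> \<cdot>\<^sub>m 1\<^sub>m N + complex_mat K"
    "complex_mat (shift_minus \<alpha> K) = of_real \<alpha> \<cdot>\<^sub>m 1\<^sub>m N - complex_mat K"
    using K by (auto simp: shift_plus_def shift_minus_def intro!: eq_matI)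
  then show "complex_mat (shift_plus \<alpha> K) *\<^sub>v v = of_real \<alpha> \<cdot>\<^sub>v v + complex_mat K *\<^sub>v v"
    "complex_mat (shift_minus \<alpha> K) *\<^sub>v v = of_real \<alpha> \<cdot>\<^sub>v v - complex_mat K *\<^sub>v v"
    using K v
    by (auto simp: add_mult_distrib_mat_vec[of _ N N] minus_mult_distrib_mat_vec[of _ N N]
        intro!: eq_vecI)
qed

lemma shift_carrier [simp]:
  assumes "K \<in> carrier_mat N N"
  shows "shift_plus \<alpha> K \<in> carrier_mat N N" "shift_minus \<alpha> K \<in> carrier_mat N N"
  using assms by (auto simp: shift_plus_def shift_minus_def)

text \<open>Division-free form of the correspondence \<open>\<theta> = \<alpha> (1 - \<mu>) / (1 + \<mu>)\<close>, valid also before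
  \<open>\<mu> \<noteq> -1\<close> is known.\<close>

lemma ss_mat_eigenvector_iff:
  assumes K: "K \<in> carrier_mat N N" and det: "det (shift_plus \<alpha> K) \<noteq> 0"
    and v: "v \<in> carrier_vec N"
  shows "complex_mat (ss_mat \<alpha> K) *\<^sub>v v = \<mu> \<cdot>\<^sub>v v \<longleftrightarrow>
    (1 + \<mu>) \<cdot>\<^sub>v (complex_mat K *\<^sub>v v) = (of_real \<alpha> * (1 - \<mu>)) \<cdot>\<^sub>v v"
proof -
  let ?P = "shift_plus \<alpha> K" and ?Q = "shift_minus \<alpha> K"
  let ?M = "complex_mat (ss_mat \<alpha> K)"
  note inv = inv_mat_nonsingular[OF shift_carrier(1)[OF K] det]
  have M: "ss_mat \<alpha> K \<in> carrier_mat N N" using inv(1) K by (simp add: ss_mat_def)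
  \<comment> \<open>Multiplication by \<open>?P\<close> removes the inverse and turns the eigenvalue
    equation into \<open>?Q v = \<mu> ?P v\<close>. Since \<open>?P\<close> is nonsingular, nothing
    is lost.\<close>
  have "?P * ss_mat \<alpha> K = ?Q"
    using assoc_mult_mat[OF shift_carrier(1)[OF K] inv(1) shift_carrier(2)[OF K]] inv(2)
      left_mult_one_mat[OF shift_carrier(2)[OF K]]
    unfolding ss_mat_def by metis
  then have PM: "complex_mat ?P * ?M = complex_mat ?Q"
    using of_real_hom.mat_hom_mult[OF shift_carrier(1)[OF K] M] by metis
  have "det (complex_mat ?P) \<noteq> 0" using det by (simp add: of_real_hom.hom_det)
  moreover have "?M *\<^sub>v v \<in> carrier_vec N" using M v by simp
  ultimately have "?M *\<^sub>v v = \<mu> \<cdot>\<^sub>v v \<longleftrightarrow> complex_mat ?P *\<^sub>v (?M *\<^sub>v v) = complex_mat ?P *\<^sub>v (\<mu> \<cdot>\<^sub>v v)"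
    using nonsingular_mult_vec_cancel[of "complex_mat ?P" N] shift_carrier(1)[OF K] v by simp
  also have "complex_mat ?P *\<^sub>v (?M *\<^sub>v v) = of_real \<alpha> \<cdot>\<^sub>v v - complex_mat K *\<^sub>v v"
    using PM complex_shift_mult_vec(2)[OF K v] K M v
      assoc_mult_mat_vec[of "complex_mat ?P" N N ?M N v] by simp
  also have "complex_mat ?P *\<^sub>v (\<mu> \<cdot>\<^sub>v v) = \<mu> \<cdot>\<^sub>v (of_real \<alpha> \<cdot>\<^sub>v v + complex_mat K *\<^sub>v v)"
    using complex_shift_mult_vec(1)[OF K v] K v mult_mat_vec[of "complex_mat ?P" N N v \<mu>] by simp
  also have "of_real \<alpha> \<cdot>\<^sub>v v - complex_mat K *\<^sub>v v = \<mu> \<cdot>\<^sub>v (of_real \<alpha> \<cdot>\<^sub>v v + complex_mat K *\<^sub>v v) \<longleftrightarrow>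
      (1 + \<mu>) \<cdot>\<^sub>v (complex_mat K *\<^sub>v v) = (of_real \<alpha> * (1 - \<mu>)) \<cdot>\<^sub>v v"
  proof -
    \<comment> \<open>Here \<open>a\<close> and \<open>b\<close> stand for corresponding entries of
      \<open>v\<close> and of \<open>K v\<close>.\<close>
    have "of_real \<alpha> * a - b = \<mu> * (of_real \<alpha> * a + b) \<longleftrightarrow> (1 + \<mu>) * b = of_real \<alpha> * (1 - \<mu>) * a"
      for a b :: complex
    proof -
      have "of_real \<alpha> * a - b - \<mu> * (of_real \<alpha> * a + b) = - ((1 + \<mu>) * b - of_real \<alpha> * (1 - \<mu>) * a)"
        by (simp add: algebra_simps)
      then show ?thesis by (metis eq_iff_diff_eq_0 neg_equal_0_iff_equal)
    qed
    then show ?thesis using K v by (simp add: vec_eq_iff del: index_mult_mat_vec)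
  qed
  finally show ?thesis .
qed

text \<open>The relation reads \<open>(\<alpha> + \<theta>) * \<mu> = \<alpha> - \<theta>\<close>.
  Comparing squared moduli yields \<open>\<bar>\<alpha> + \<theta>\<bar>\<^sup>2 * (1 -
  \<bar>\<mu>\<bar>\<^sup>2) = 4 * \<alpha> * Re \<theta>\<close>, and
  \<open>\<theta> = -\<alpha>\<close> is impossible since it would give
  \<open>2 * \<alpha> = 0\<close>.\<close>

lemma cayley_norm_less_1_iff:
  fixes \<alpha> :: real and \<theta> \<mu> :: complex
  assumes \<alpha>: "\<alpha> > 0" and eq: "\<theta> * (1 + \<mu>) = of_real \<alpha> * (1 - \<mu>)"
  shows "norm \<mu> < 1 \<longleftrightarrow> Re \<theta> > 0"
proof -
  have eq': "(of_real \<alpha> + \<theta>) * \<mu> = of_real \<alpha> - \<theta>" using eq by (simp add: algebra_simps)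
  have nz: "of_real \<alpha> + \<theta> \<noteq> 0"
  proof
    assume "of_real \<alpha> + \<theta> = 0"
    then have "\<theta> = - of_real \<alpha>" by (simp add: add_eq_0_iff)
    then show False using eq' \<alpha> by simp
  qed
  have "(norm (of_real \<alpha> + \<theta>))\<^sup>2 * (norm \<mu>)\<^sup>2 = (norm (of_real \<alpha> - \<theta>))\<^sup>2"
    by (simp add: eq'[symmetric] norm_mult power_mult_distrib)
  also have "\<dots> = (norm (of_real \<alpha> + \<theta>))\<^sup>2 - 4 * \<alpha> * Re \<theta>"
    by (simp add: cmod_power2) (simp add: algebra_simps power2_eq_square)
  finally have "(norm (of_real \<alpha> + \<theta>))\<^sup>2 * (1 - (norm \<mu>)\<^sup>2) = 4 * \<alpha> * Re \<theta>"
    by (simp add: algebra_simps)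
  then have "1 - (norm \<mu>)\<^sup>2 > 0 \<longleftrightarrow> Re \<theta> > 0"
    using \<alpha> nz by (metis mult_pos_pos zero_less_mult_pos zero_less_norm_iff zero_less_numeral zero_less_power)
  then show ?thesis by (simp add: abs_square_less_1)
qed

section \<open>Closed form of the iteration\<close>

text \<open>The solution \<open>x\<close> is a fixed point of the step, so subtracting it removes
  \<open>f\<close> and leaves a homogeneous recursion for the error. Being an equivalence, the
  closed form gives both existence and uniqueness of the iterates.\<close>

lemma ss_iteration_iff:
  assumes K: "K \<in> carrier_mat N N" and det: "det (shift_plus \<alpha> K) \<noteq> 0"
    and f: "f \<in> carrier_vec N" and x0: "x0 \<in> carrier_vec N"
    and x: "x \<in> carrier_vec N" "K *\<^sub>v x = f"
  shows "ss_iteration \<alpha> K f x0 X \<longleftrightarrow> (\<forall>k. X k = x + ss_mat \<alpha> K ^\<^sub>m k *\<^sub>v (x0 - x))"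
proof -
  let ?P = "shift_plus \<alpha> K" and ?Q = "shift_minus \<alpha> K"
  let ?M = "ss_mat \<alpha> K"
  note inv = inv_mat_nonsingular[OF shift_carrier(1)[OF K] det]
  have M: "?M \<in> carrier_mat N N" using inv(1) K by (simp add: ss_mat_def)
  \<comment> \<open>The shifted matrices differ by \<open>2 K\<close>, and
    \<open>K x = f\<close>.\<close>
  have Px: "?P *\<^sub>v x = ?Q *\<^sub>v x + 2 \<cdot>\<^sub>v f"
    using K x f by (auto simp: shift_mult_vec intro!: eq_vecI)
  have step: "?P *\<^sub>v z' = ?Q *\<^sub>v z + 2 \<cdot>\<^sub>v f \<longleftrightarrow> z' = x + ?M *\<^sub>v (z - x)"
    if z: "z \<in> carrier_vec N" and z': "z' \<in> carrier_vec N" for z z'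
  proof -
    have zx: "z - x \<in> carrier_vec N" and zx': "z' - x \<in> carrier_vec N" using z z' x by auto
    have Qzx: "?Q *\<^sub>v (z - x) \<in> carrier_vec N"
      by (rule mult_mat_vec_carrier[OF shift_carrier(2)[OF K] zx])
    have Qz: "?Q *\<^sub>v z \<in> carrier_vec N" and Qx: "?Q *\<^sub>v x \<in> carrier_vec N"
      and Pz': "?P *\<^sub>v z' \<in> carrier_vec N" and Px': "?P *\<^sub>v x \<in> carrier_vec N"
      and Mzx: "?M *\<^sub>v (z - x) \<in> carrier_vec N"
      using z z' x zx M shift_carrier[OF K] by (auto intro: mult_mat_vec_carrier)
    have "?P *\<^sub>v x + (?Q *\<^sub>v z - ?Q *\<^sub>v x) = ?Q *\<^sub>v z + 2 \<cdot>\<^sub>v f"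
    proof -
      have "u + 2 \<cdot>\<^sub>v f + (w - u) = w + 2 \<cdot>\<^sub>v f" if "u \<in> carrier_vec N" "w \<in> carrier_vec N" for u w
        using that f by (intro eq_vecI) auto
      then show ?thesis unfolding Px using Qx Qz by blast
    qed
    then have "?P *\<^sub>v z' = ?Q *\<^sub>v z + 2 \<cdot>\<^sub>v f \<longleftrightarrow> ?P *\<^sub>v z' - ?P *\<^sub>v x = ?Q *\<^sub>v z - ?Q *\<^sub>v x"
      using vec_diff_eq_iff[OF Pz' Px', of "?Q *\<^sub>v z - ?Q *\<^sub>v x"] Qz Qx by simp
    also have "?P *\<^sub>v z' - ?P *\<^sub>v x = ?P *\<^sub>v (z' - x)"
      by (rule mult_minus_distrib_mat_vec[OF shift_carrier(1)[OF K] z' x(1), symmetric])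
    also have "?Q *\<^sub>v z - ?Q *\<^sub>v x = ?Q *\<^sub>v (z - x)"
      by (rule mult_minus_distrib_mat_vec[OF shift_carrier(2)[OF K] z x(1), symmetric])
    also have "?P *\<^sub>v (z' - x) = ?Q *\<^sub>v (z - x) \<longleftrightarrow> z' - x = ?M *\<^sub>v (z - x)"
      using nonsingular_mult_vec_eq_iff[OF shift_carrier(1)[OF K] det zx' Qzx]
        assoc_mult_mat_vec[OF inv(1) shift_carrier(2)[OF K] zx] by (simp add: ss_mat_def)
    also have "\<dots> \<longleftrightarrow> z' = x + ?M *\<^sub>v (z - x)"
      by (rule vec_diff_eq_iff[OF z' x(1) Mzx])
    finally show ?thesis .
  qed
  define Y where "Y k = x + ?M ^\<^sub>m k *\<^sub>v (x0 - x)" for k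
  have x0x: "x0 - x \<in> carrier_vec N" using x0 x by simp
  have Mk: "?M ^\<^sub>m k *\<^sub>v (x0 - x) \<in> carrier_vec N" for k
    using M x0x by (meson mult_mat_vec_carrier pow_carrier_mat)
  have Y: "Y k \<in> carrier_vec N" for k using Mk x by (simp add: Y_def)
  have Y0: "Y 0 = x0" using M x0 x by (auto simp: Y_def intro!: eq_vecI)
  have pow_Suc: "?M ^\<^sub>m Suc k = ?M * ?M ^\<^sub>m k" for k
    by (rule pow_mat_Suc_left[OF M])
  have YSuc: "Y (Suc k) = x + ?M *\<^sub>v (Y k - x)" for k
  proof -
    have diff: "Y k - x = ?M ^\<^sub>m k *\<^sub>v (x0 - x)"
      using vec_diff_eq_iff[OF Y x(1) Mk] by (simp add: Y_def)
    then show ?thesis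
      unfolding diff Y_def[of "Suc k"] pow_Suc
      by (simp only: assoc_mult_mat_vec[OF M pow_carrier_mat[OF M] x0x])
  qed
  have eq_Y: "X k = Y k" if X: "ss_iteration \<alpha> K f x0 X" for k
  proof (induction k)
    case 0
    then show ?case using X Y0 by (simp add: ss_iteration_def)
  next
    case (Suc k)
    then show ?case using X K step[of "X k" "X (Suc k)"] YSuc Y[of k] by (simp add: ss_iteration_def)
  qed
  \<comment> \<open>This is the existence half: the closed form itself satisfies the implicit
    equations.\<close>
  have iter_Y: "ss_iteration \<alpha> K f x0 Y"
  proof -
    have "?P *\<^sub>v Y (Suc k) = ?Q *\<^sub>v Y k + 2 \<cdot>\<^sub>v f" for k
      using step[OF Y[of k] Y[of "Suc k"]] YSuc[of k] by (rule iffD2)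
    then show ?thesis unfolding ss_iteration_def using Y0 Y K by auto
  qed
  show ?thesis
  proof
    show "\<forall>k. X k = x + ?M ^\<^sub>m k *\<^sub>v (x0 - x)" if "ss_iteration \<alpha> K f x0 X"
      using eq_Y[OF that] unfolding Y_def by blast
    assume "\<forall>k. X k = x + ?M ^\<^sub>m k *\<^sub>v (x0 - x)"
    then have "X = Y" unfolding Y_def by blast
    then show "ss_iteration \<alpha> K f x0 X" using iter_Y by simp
  qed
qed

section \<open>Nonsingularity, spectral radius and convergence\<close>

theorem theorem1:
  fixes n m :: nat and A B C :: "real mat" and b q :: "real vec" and \<alpha> :: real
  assumes n_pos: "0 < n" and mn: "m \<le> n"
    and A: "A \<in> carrier_mat n n" "sym_pos_def A"
    and B: "B \<in> carrier_mat m n" "vec_space.rank m B = m"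
    and C: "C \<in> carrier_mat m n" "vec_space.rank m C = m"
    and b: "b \<in> carrier_vec n" and q: "q \<in> carrier_vec m"
    and \<alpha>: "\<alpha> > 0"
    and S: "\<forall>x \<in> S_set \<alpha> A B C.
      s_form B C x > 0 \<and> \<bar>t_form B C x\<bar> < a_form A x * sqrt (s_form B C x)"
  shows "invertible_mat (shift_plus \<alpha> (saddle_mat A B C)) \<and>
    spectral_radius (complex_mat (ss_mat \<alpha> (saddle_mat A B C))) < 1 \<and>
    (\<exists>x \<in> carrier_vec (n + m).
      (\<forall>z \<in> carrier_vec (n + m). saddle_mat A B C *\<^sub>v z = b @\<^sub>v q \<longleftrightarrow> z = x) \<and>
      (\<forall>x0 \<in> carrier_vec (n + m).
        (\<exists>!X. ss_iteration \<alpha> (saddle_mat A B C) (b @\<^sub>v q) x0 X) \<and>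
        (\<forall>X. ss_iteration \<alpha> (saddle_mat A B C) (b @\<^sub>v q) x0 X \<longrightarrow>
          (\<lambda>k. vec_norm2 (X k - x)) \<longlonglongrightarrow> 0)))"
proof -
  define K where "K = saddle_mat A B C"
  define M where "M = ss_mat \<alpha> K"
  let ?P = "shift_plus \<alpha> K" and ?f = "b @\<^sub>v q"
  have sym: "transpose_mat A = A" using A(2) by (simp add: sym_pos_def_def)
  have K: "K \<in> carrier_mat (n + m) (n + m)" using A(1) B(1) C(1) by (simp add: K_def saddle_mat_def)
  have f: "?f \<in> carrier_vec (n + m)" using b q by simp
  have N: "n + m > 0" using n_pos by simp
  have S_I: "s_form B C x > 0 \<and> \<bar>t_form B C x\<bar> < a_form A x * sqrt (s_form B C x)"
    if "x \<in> carrier_vec n" "y \<in> carrier_vec m" "vec_norm2 x = 1" "eigenvector (complex_mat M) (x @\<^sub>v y) \<mu>"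
    for x y \<mu>
    using S that A(1) B(1) by (auto simp: S_set_def M_def K_def)
  \<comment> \<open>Nonsingularity is derived, not assumed. A kernel vector of \<open>?P\<close> is
    an eigenvector of \<open>K\<close> for \<open>-\<alpha>\<close>, and positivity of the real part
    of that eigenvalue contradicts \<open>\<alpha> > 0\<close>.\<close>
  have det_P: "det ?P \<noteq> 0"
  proof
    assume det: "det ?P = 0"
    then have "det (complex_mat ?P) = 0" by (simp add: of_real_hom.hom_det)
    then obtain v where v: "v \<in> carrier_vec (n + m)" "v \<noteq> 0\<^sub>v (n + m)"
        "complex_mat ?P *\<^sub>v v = 0\<^sub>v (n + m)"
      using det_0_iff_vec_prod_zero_field[of "complex_mat ?P" "n + m"] K by auto
    have "complex_mat K *\<^sub>v v = - of_real \<alpha> \<cdot>\<^sub>v v"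
      using v K complex_shift_mult_vec(1)[OF K v(1), of \<alpha>]
      by (auto simp: vec_eq_iff add_eq_0_iff simp del: index_mult_mat_vec)
    then have e: "eigenvector (complex_mat (saddle_mat A B C)) v (- of_real \<alpha>)"
      using v K by (simp add: eigenvector_def K_def)
    \<comment> \<open>A singular \<open>\<alpha>I + K\<close> makes the junk value \<open>M = 0\<close>, so the hypothesis covers all unit vectors.\<close>
    have M0: "M = 0\<^sub>m (n + m) (n + m)"
      unfolding M_def ss_mat_def inv_mat_singular[OF shift_carrier(1)[OF K] det]
      by (rule left_mult_zero_mat[OF shift_carrier(2)[OF K]])
    have "Re (- of_real \<alpha>) > 0"
    proof (rule saddle_eigenvalue_Re_pos[OF A(1) sym B C(1) e])
      fix x y :: "complex vec"
      assume x: "x \<in> carrier_vec n" "vec_norm2 x = 1" and y: "y \<in> carrier_vec m"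
        and xy: "eigenvector (complex_mat (saddle_mat A B C)) (x @\<^sub>v y) (- of_real \<alpha>)"
      have "eigenvector (complex_mat M) (x @\<^sub>v y) 0"
      proof -
        have "complex_mat M = 0\<^sub>m (n + m) (n + m)" by (intro eq_matI) (auto simp: M0)
        moreover have "0\<^sub>m (n + m) (n + m) *\<^sub>v (x @\<^sub>v y) = 0 \<cdot>\<^sub>v (x @\<^sub>v y)"
          using x y by (intro eq_vecI) auto
        ultimately show ?thesis
          using xy x y K unfolding K_def by (simp add: eigenvector_def)
      qed
      then show "s_form B C x > 0 \<and> \<bar>t_form B C x\<bar> < a_form A x * sqrt (s_form B C x)"
        using S_I x y by blast
    qed
    then show False using \<alpha> by simp
  qed
  note inv = inv_mat_nonsingular[OF shift_carrier(1)[OF K] det_P]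
  have M: "M \<in> carrier_mat (n + m) (n + m)"
    unfolding M_def ss_mat_def by (rule mult_carrier_mat[OF inv(1) shift_carrier(2)[OF K]])
  have invertible: "invertible_mat ?P"
    using inv shift_carrier(1)[OF K, of \<alpha>]
    by (auto simp: invertible_mat_def inverts_mat_def)
  \<comment> \<open>Here \<open>\<mu>\<close> is tied to \<open>\<theta>\<close> only by the
    division-free relation. Every eigenvector of \<open>K\<close> for \<open>\<theta>\<close> is
    then one of \<open>M\<close> for \<open>\<mu>\<close>, which brings the hypothesis on
    \<open>S_set\<close> into play.\<close>
  have Re_pos: "Re \<theta> > 0"
    if e: "eigenvector (complex_mat K) v \<theta>" and eq: "\<theta> * (1 + \<mu>) = of_real \<alpha> * (1 - \<mu>)" for v \<theta> \<mu>
  proof (rule saddle_eigenvalue_Re_pos[OF A(1) sym B C(1) e[unfolded K_def]])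
    fix x y :: "complex vec"
    assume x: "x \<in> carrier_vec n" "vec_norm2 x = 1" and y: "y \<in> carrier_vec m"
      and "eigenvector (complex_mat (saddle_mat A B C)) (x @\<^sub>v y) \<theta>"
    then have xy: "eigenvector (complex_mat K) (x @\<^sub>v y) \<theta>" by (simp add: K_def)
    have "(1 + \<mu>) \<cdot>\<^sub>v (complex_mat K *\<^sub>v (x @\<^sub>v y)) = (of_real \<alpha> * (1 - \<mu>)) \<cdot>\<^sub>v (x @\<^sub>v y)"
      using xy by (simp add: eigenvector_def smult_smult_assoc eq[symmetric] mult.commute)
    then have "eigenvector (complex_mat M) (x @\<^sub>v y) \<mu>"
      using ss_mat_eigenvector_iff[OF K det_P, of "x @\<^sub>v y" \<mu>] xy x y M K
      by (simp add: eigenvector_def M_def)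
    then show "s_form B C x > 0 \<and> \<bar>t_form B C x\<bar> < a_form A x * sqrt (s_form B C x)"
      using S_I x y by blast
  qed
  have rho: "spectral_radius (complex_mat M) < 1"
  proof -
    obtain \<mu> v where \<mu>: "spectral_radius (complex_mat M) = norm \<mu>"
      and v: "v \<in> carrier_vec (n + m)" "v \<noteq> 0\<^sub>v (n + m)" "complex_mat M *\<^sub>v v = \<mu> \<cdot>\<^sub>v v"
      using spectral_radius_mem_max(1)[of "complex_mat M" "n + m"] M N
      by (auto simp: spectrum_def eigenvalue_def eigenvector_def)
    have Kv: "(1 + \<mu>) \<cdot>\<^sub>v (complex_mat K *\<^sub>v v) = (of_real \<alpha> * (1 - \<mu>)) \<cdot>\<^sub>v v"
      using ss_mat_eigenvector_iff[OF K det_P v(1)] v(3) by (simp add: M_def)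
    \<comment> \<open>For \<open>\<mu> = -1\<close> the equation \<open>Kv\<close> would read
      \<open>0 = 2 \<alpha> v\<close>.\<close>
    have nz: "1 + \<mu> \<noteq> 0"
    proof
      assume "1 + \<mu> = 0"
      then have "\<mu> = -1" by (simp add: add_eq_0_iff)
      then have "v = 0\<^sub>v (n + m)"
        using Kv v(1) K \<alpha> by (auto simp: vec_eq_iff simp del: index_mult_mat_vec)
      then show False using v(2) by simp
    qed
    define \<theta> where "\<theta> = of_real \<alpha> * (1 - \<mu>) / (1 + \<mu>)"
    have eq: "\<theta> * (1 + \<mu>) = of_real \<alpha> * (1 - \<mu>)" using nz by (simp add: \<theta>_def)
    have "complex_mat K *\<^sub>v v = (1 / (1 + \<mu>)) \<cdot>\<^sub>v ((1 + \<mu>) \<cdot>\<^sub>v (complex_mat K *\<^sub>v v))"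
      using nz by (simp add: smult_smult_assoc)
    also have "\<dots> = \<theta> \<cdot>\<^sub>v v" by (simp add: Kv smult_smult_assoc \<theta>_def)
    finally have "eigenvector (complex_mat K) v \<theta>" using v K by (simp add: eigenvector_def)
    then show ?thesis using Re_pos[OF _ eq] cayley_norm_less_1_iff[OF \<alpha> eq] \<mu> by simp
  qed
  have det_K: "det K \<noteq> 0"
  proof
    assume "det K = 0"
    then have "det (complex_mat K) = 0" by (simp add: of_real_hom.hom_det)
    then obtain v where v: "v \<in> carrier_vec (n + m)" "v \<noteq> 0\<^sub>v (n + m)"
        "complex_mat K *\<^sub>v v = 0\<^sub>v (n + m)"
      using det_0_iff_vec_prod_zero_field[of "complex_mat K" "n + m"] K by auto
    have "eigenvector (complex_mat K) v 0"
      using v K by (auto simp: eigenvector_def intro!: eq_vecI)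
    \<comment> \<open>The eigenvalue \<open>\<theta> = 0\<close> of \<open>K\<close> corresponds to
      \<open>\<mu> = 1\<close>, for which both sides of the relation vanish.\<close>
    from Re_pos[OF this, of 1] show False by simp
  qed
  define x where "x = inv_mat K *\<^sub>v ?f"
  have x: "x \<in> carrier_vec (n + m)"
    unfolding x_def by (rule mult_mat_vec_carrier[OF inv_mat_nonsingular(1)[OF K det_K] f])
  have solution: "K *\<^sub>v z = ?f \<longleftrightarrow> z = x" if "z \<in> carrier_vec (n + m)" for z
    unfolding x_def by (rule nonsingular_mult_vec_eq_iff[OF K det_K that f])
  have iteration: "ss_iteration \<alpha> K ?f x0 X \<longleftrightarrow> (\<forall>k. X k = x + M ^\<^sub>m k *\<^sub>v (x0 - x))"
    if "x0 \<in> carrier_vec (n + m)" for x0 X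
    unfolding M_def using ss_iteration_iff[OF K det_P f that x] solution[OF x] by blast
  \<comment> \<open>The closed form prescribes every term, so the sequence is determined as a
    function of \<open>k\<close>.\<close>
  have unique: "\<exists>!X. ss_iteration \<alpha> K ?f x0 X" if "x0 \<in> carrier_vec (n + m)" for x0
    unfolding iteration[OF that] fun_eq_iff[symmetric] by simp
  have conv: "(\<lambda>k. vec_norm2 (X k - x)) \<longlonglongrightarrow> 0"
    if x0: "x0 \<in> carrier_vec (n + m)" and X: "ss_iteration \<alpha> K ?f x0 X" for x0 X
  proof -
    have x0x: "x0 - x \<in> carrier_vec (n + m)" using x0 x by simp
    have "X k - x = M ^\<^sub>m k *\<^sub>v (x0 - x)" for k
    proof -
      have Mk: "M ^\<^sub>m k *\<^sub>v (x0 - x) \<in> carrier_vec (n + m)"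
        by (rule mult_mat_vec_carrier[OF pow_carrier_mat[OF M] x0x])
      have "X k = x + M ^\<^sub>m k *\<^sub>v (x0 - x)" using X iteration[OF x0] by blast
      then show ?thesis using vec_diff_eq_iff[OF add_carrier_vec[OF x Mk] x Mk] by simp
    qed
    then show ?thesis using vec_norm2_pow_mat_mult_vec_tendsto_0[OF M N rho x0x] by simp
  qed
  show ?thesis
    unfolding K_def[symmetric] M_def[symmetric]
    by (intro conjI bexI[OF _ x] ballI allI impI)
      (erule conv unique solution | rule invertible rho | assumption)+
qed

end
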